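(* Let $S$ be a quandle and $T$ a medial quandle. Then $T$ satisfies an identity if and only if $\mathrm{Hom}(S,T)$ does; that is, for every identity $p(x_1,\dots,x_n)=q(x_1,\dots,x_n)$ between quandle terms, $T$ satisfies $p=q$ if and only if $\mathrm{Hom}(S,T)$ satisfies $p=q$.
   Context: A quandle is a non-empty set $Q$ with a binary operation $\triangleright$ such that $x\triangleright x=x$; for all $y,z$ there is a unique $x$ with $y\triangleright x=z$; and $x\triangleright(y\triangleright z)=(x\triangleright y)\triangleright(x\triangleright z)$. It is medial if $(x\triangleright y)\triangleright(z\triangleright w)=(x\triangleright z)\triangleright(y\triangleright w)$ for all $x,y,z,w$. For $T$ medial, $\mathrm{Hom}(S,T)$, the set of quandle homomorphisms, is a (medial) quandle under the pointwise operation $(h\triangleright k)(a)=h(a)\triangleright k(a)$ (known). A quandle satisfies an identity if the equation holds for all values of the variables. *)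

theory Defs
  imports "HOL-Algebra.Congruence" "HOL-Library.FuncSet"
begin

record 'a qstruct = "'a partial_object" +
  qop :: "'a \<Rightarrow> 'a \<Rightarrow> 'a"  (infixl \<open>\<rhd>\<index>\<close> 70)

locale quandle =
  fixes Q (structure)
  assumes nonempty: "carrier Q \<noteq> {}"
    and closed: "\<lbrakk>x \<in> carrier Q; y \<in> carrier Q\<rbrakk> \<Longrightarrow> x \<rhd> y \<in> carrier Q"
    and idem: "x \<in> carrier Q \<Longrightarrow> x \<rhd> x = x"
    and ex1_left_quotient:
      "\<lbrakk>y \<in> carrier Q; z \<in> carrier Q\<rbrakk> \<Longrightarrow> \<exists>!x. x \<in> carrier Q \<and> y \<rhd> x = z"
    and left_distrib:
      "\<lbrakk>x \<in> carrier Q; y \<in> carrier Q; z \<in> carrier Q\<rbrakk>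
        \<Longrightarrow> x \<rhd> (y \<rhd> z) = (x \<rhd> y) \<rhd> (x \<rhd> z)"

locale medial_quandle = quandle +
  assumes medial:
    "\<lbrakk>x \<in> carrier Q; y \<in> carrier Q; z \<in> carrier Q; w \<in> carrier Q\<rbrakk>
      \<Longrightarrow> (x \<rhd> y) \<rhd> (z \<rhd> w) = (x \<rhd> z) \<rhd> (y \<rhd> w)"

text \<open>The unique solution \<open>x\<close> of \<open>y \<rhd> x = z\<close> in the carrier.\<close>

definition left_div :: "('a, 'b) qstruct_scheme \<Rightarrow> 'a \<Rightarrow> 'a \<Rightarrow> 'a" where
  "left_div Q y z = (THE x. x \<in> carrier Q \<and> y \<rhd>\<^bsub>Q\<^esub> x = z)"

text \<open>Homomorphisms are taken extensional (\<open>undefined\<close> off the carrier of \<open>S\<close>), so that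
  equality of elements of \<open>Hom_quandle S T\<close> is equality of maps on the carrier of \<open>S\<close>.\<close>

definition quandle_hom ::
    "('a, 'c) qstruct_scheme \<Rightarrow> ('b, 'd) qstruct_scheme \<Rightarrow> ('a \<Rightarrow> 'b) set" where
  "quandle_hom S T =
     {h \<in> carrier S \<rightarrow>\<^sub>E carrier T.
        \<forall>a\<in>carrier S. \<forall>b\<in>carrier S. h (a \<rhd>\<^bsub>S\<^esub> b) = h a \<rhd>\<^bsub>T\<^esub> h b}"

definition Hom_quandle ::
    "('a, 'c) qstruct_scheme \<Rightarrow> ('b, 'd) qstruct_scheme \<Rightarrow> ('a \<Rightarrow> 'b) qstruct" where
  "Hom_quandle S T =
     \<lparr>carrier = quandle_hom S T, qop = (\<lambda>h k. \<lambda>a\<in>carrier S. h a \<rhd>\<^bsub>T\<^esub> k a)\<rparr>"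

text \<open>Terms may use left division as well as the quandle operation, since each quandle
  determines both; identities in the quandle operation alone are those between terms
  without \<open>LDiv\<close>.\<close>

datatype qterm = Var nat | Op qterm qterm | LDiv qterm qterm

primrec qeval :: "('a, 'b) qstruct_scheme \<Rightarrow> (nat \<Rightarrow> 'a) \<Rightarrow> qterm \<Rightarrow> 'a" where
  "qeval Q v (Var i) = v i"
| "qeval Q v (Op s t) = qeval Q v s \<rhd>\<^bsub>Q\<^esub> qeval Q v t"
| "qeval Q v (LDiv s t) = left_div Q (qeval Q v s) (qeval Q v t)"

definition satisfies_identity :: "('a, 'b) qstruct_scheme \<Rightarrow> qterm \<Rightarrow> qterm \<Rightarrow> bool" where
  "satisfies_identity Q p q \<longleftrightarrow>
     (\<forall>v. (\<forall>i. v i \<in> carrier Q) \<longrightarrow> qeval Q v p = qeval Q v q)"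

end

theory Submission imports Defs begin

text \<open>Terms over \<open>Hom(S,T)\<close> are evaluated pointwise, so identities of \<open>T\<close> pass to
  \<open>Hom(S,T)\<close>. Conversely, since \<open>T\<close> is idempotent and \<open>S\<close> is nonempty, the constant maps
  embed \<open>T\<close> into \<open>Hom(S,T)\<close>.\<close>

context quandle
begin

lemma left_div_closed:
  "\<lbrakk>y \<in> carrier Q; z \<in> carrier Q\<rbrakk> \<Longrightarrow> left_div Q y z \<in> carrier Q"
  unfolding left_div_def using theI'[OF ex1_left_quotient] by blast

lemma op_left_div:
  "\<lbrakk>y \<in> carrier Q; z \<in> carrier Q\<rbrakk> \<Longrightarrow> y \<rhd> left_div Q y z = z"
  unfolding left_div_def using theI'[OF ex1_left_quotient] by blast

lemma left_div_eqI:
  "\<lbrakk>y \<in> carrier Q; x \<in> carrier Q; y \<rhd> x = z\<rbrakk> \<Longrightarrow> left_div Q y z = x"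
  using ex1_left_quotient[of y z] closed left_div_closed op_left_div by metis

end

lemma carrier_Hom_quandle [simp]: "carrier (Hom_quandle S T) = quandle_hom S T"
  by (simp add: Hom_quandle_def)

lemma qop_Hom_quandle [simp]:
  "h \<rhd>\<^bsub>Hom_quandle S T\<^esub> k = (\<lambda>a\<in>carrier S. h a \<rhd>\<^bsub>T\<^esub> k a)"
  by (simp add: Hom_quandle_def)

lemma quandle_homI:
  assumes "\<And>a. a \<in> carrier S \<Longrightarrow> h a \<in> carrier T"
    and "\<And>a. a \<notin> carrier S \<Longrightarrow> h a = undefined"
    and "\<And>a b. \<lbrakk>a \<in> carrier S; b \<in> carrier S\<rbrakk> \<Longrightarrow> h (a \<rhd>\<^bsub>S\<^esub> b) = h a \<rhd>\<^bsub>T\<^esub> h b"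
  shows "h \<in> quandle_hom S T"
  using assms unfolding quandle_hom_def by auto

lemma quandle_hom_closed:
  "\<lbrakk>h \<in> quandle_hom S T; a \<in> carrier S\<rbrakk> \<Longrightarrow> h a \<in> carrier T"
  unfolding quandle_hom_def by auto

lemma quandle_hom_op:
  "\<lbrakk>h \<in> quandle_hom S T; a \<in> carrier S; b \<in> carrier S\<rbrakk>
    \<Longrightarrow> h (a \<rhd>\<^bsub>S\<^esub> b) = h a \<rhd>\<^bsub>T\<^esub> h b"
  unfolding quandle_hom_def by auto

text \<open>Both maps take the value \<open>undefined\<close> off \<open>carrier S\<close>, so
  agreement on the carrier is equality; this reduces equations in \<open>Hom_quandle S T\<close> to
  equations in \<open>T\<close>.\<close>

lemma quandle_hom_eqI:
  assumes "h \<in> quandle_hom S T" "k \<in> quandle_hom S T"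
    and "\<And>a. a \<in> carrier S \<Longrightarrow> h a = k a"
  shows "h = k"
  using assms unfolding quandle_hom_def by (auto intro: PiE_ext)

text \<open>The homomorphism law amounts to c = c \<rhd> c, which is idempotence in
  \<open>T\<close>; closure of \<open>S\<close> ensures that the restricted map still takes the
  value \<open>c\<close> at a product.\<close>

lemma const_in_quandle_hom:
  assumes "quandle S" "quandle T" "c \<in> carrier T"
  shows "(\<lambda>a\<in>carrier S. c) \<in> quandle_hom S T"
  using assms by (intro quandle_homI) (simp_all add: quandle.closed quandle.idem)

context
  fixes S :: "('a, 'c) qstruct_scheme" and T :: "('b, 'd) qstruct_scheme"
  assumes S: "quandle S" and T: "medial_quandle T"
begin

interpretation S: quandle S by (fact S)
interpretation T: medial_quandle T by (fact T)

text \<open>The homomorphism law for the pointwise product is exactly an instance of mediality: the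
  two inner factors of (h a \<rhd> h b) \<rhd> (k a \<rhd> k b) trade places.\<close>

lemma Hom_quandle_op_closed:
  assumes "h \<in> quandle_hom S T" "k \<in> quandle_hom S T"
  shows "h \<rhd>\<^bsub>Hom_quandle S T\<^esub> k \<in> quandle_hom S T"
  using assms
  by (intro quandle_homI)
    (simp_all add: quandle_hom_closed quandle_hom_op S.closed T.closed T.medial)

text \<open>Mediality makes left division in \<open>T\<close> compatible with products, which gives
  closure of homomorphisms under pointwise division. This supplies the candidate for
  \<open>left_div\<close> in \<open>Hom_quandle S T\<close>.\<close>

lemma pointwise_left_div_hom:
  assumes h: "h \<in> quandle_hom S T" and k: "k \<in> quandle_hom S T"
  shows "(\<lambda>a\<in>carrier S. left_div T (h a) (k a)) \<in> quandle_hom S T"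
proof (rule quandle_homI)
  fix a b assume a: "a \<in> carrier S" and b: "b \<in> carrier S"
  note mem = quandle_hom_closed[OF h a] quandle_hom_closed[OF h b]
    quandle_hom_closed[OF k a] quandle_hom_closed[OF k b]
  let ?x = "left_div T (h a) (k a)" and ?y = "left_div T (h b) (k b)"
  have xy: "?x \<in> carrier T" "?y \<in> carrier T"
    using mem by (simp_all add: T.left_div_closed)
  \<comment> \<open>Exchanging \<open>h b\<close> and \<open>?x\<close> places each divisor next to
    its own quotient, where the product collapses.\<close>
  have "(h a \<rhd>\<^bsub>T\<^esub> h b) \<rhd>\<^bsub>T\<^esub> (?x \<rhd>\<^bsub>T\<^esub> ?y)
      = (h a \<rhd>\<^bsub>T\<^esub> ?x) \<rhd>\<^bsub>T\<^esub> (h b \<rhd>\<^bsub>T\<^esub> ?y)"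
    using mem xy by (intro T.medial)
  also have "\<dots> = k a \<rhd>\<^bsub>T\<^esub> k b"
    using mem by (simp add: T.op_left_div)
  \<comment> \<open>The product of the quotients solves the equation that defines the left side, and
    solutions in \<open>T\<close> are unique.\<close>
  finally have "left_div T (h a \<rhd>\<^bsub>T\<^esub> h b) (k a \<rhd>\<^bsub>T\<^esub> k b) = ?x \<rhd>\<^bsub>T\<^esub> ?y"
    using mem xy by (intro T.left_div_eqI T.closed)
  then show "(\<lambda>a\<in>carrier S. left_div T (h a) (k a)) (a \<rhd>\<^bsub>S\<^esub> b)
      = (\<lambda>a\<in>carrier S. left_div T (h a) (k a)) a
        \<rhd>\<^bsub>T\<^esub> (\<lambda>a\<in>carrier S. left_div T (h a) (k a)) b"
    using a b h k by (simp add: S.closed quandle_hom_op)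
qed (use h k in \<open>simp_all add: quandle_hom_closed T.left_div_closed\<close>)

text \<open>The description in \<open>left_div\<close> ranges over homomorphisms only, so existence
  rests on the pointwise quotient being one; uniqueness is inherited from \<open>T\<close> at each
  point of \<open>S\<close>.\<close>

lemma left_div_Hom_quandle:
  assumes h: "h \<in> quandle_hom S T" and k: "k \<in> quandle_hom S T"
  shows "left_div (Hom_quandle S T) h k = (\<lambda>a\<in>carrier S. left_div T (h a) (k a))"
    (is "_ = ?x")
  unfolding left_div_def[of "Hom_quandle S T"] carrier_Hom_quandle
proof (rule the_equality)
  have "h \<rhd>\<^bsub>Hom_quandle S T\<^esub> ?x = k"
    using h k pointwise_left_div_hom[OF h k]
    by (intro quandle_hom_eqI[OF Hom_quandle_op_closed k])
      (simp_all add: quandle_hom_closed T.op_left_div)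
  then show "?x \<in> quandle_hom S T \<and> h \<rhd>\<^bsub>Hom_quandle S T\<^esub> ?x = k"
    using pointwise_left_div_hom[OF h k] by blast
next
  fix x assume x: "x \<in> quandle_hom S T \<and> h \<rhd>\<^bsub>Hom_quandle S T\<^esub> x = k"
  show "x = ?x"
  proof (rule quandle_hom_eqI)
    fix a assume a: "a \<in> carrier S"
    then have "h a \<rhd>\<^bsub>T\<^esub> x a = k a" using x by auto
    then show "x a = ?x a"
      using a h x by (metis T.left_div_eqI quandle_hom_closed restrict_apply')
  qed (use x pointwise_left_div_hom[OF h k] in auto)
qed

text \<open>Evaluation at a point of \<open>S\<close> commutes with both term operations. Membership
  is carried through the induction because the formula for \<open>left_div\<close> applies only to
  homomorphisms.\<close>

lemma qeval_Hom_quandle: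
  assumes v: "\<And>i. v i \<in> quandle_hom S T"
  shows "qeval (Hom_quandle S T) v t \<in> quandle_hom S T \<and>
    (\<forall>a\<in>carrier S. qeval (Hom_quandle S T) v t a = qeval T (\<lambda>i. v i a) t)"
proof (induction t)
  case (Op s t)
  then have "qeval (Hom_quandle S T) v (Op s t) \<in> quandle_hom S T"
    unfolding qeval.simps by (intro Hom_quandle_op_closed) auto
  moreover have "qeval (Hom_quandle S T) v (Op s t) a = qeval T (\<lambda>i. v i a) (Op s t)"
    if "a \<in> carrier S" for a
    using Op that by simp
  ultimately show ?case by (intro conjI ballI)
next
  case (LDiv s t)
  then have eq: "qeval (Hom_quandle S T) v (LDiv s t) =
      (\<lambda>a\<in>carrier S. left_div T (qeval (Hom_quandle S T) v s a)
        (qeval (Hom_quandle S T) v t a))"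
    by (simp add: left_div_Hom_quandle)
  have "qeval (Hom_quandle S T) v (LDiv s t) \<in> quandle_hom S T"
    unfolding eq using LDiv by (intro pointwise_left_div_hom) auto
  moreover have "qeval (Hom_quandle S T) v (LDiv s t) a = qeval T (\<lambda>i. v i a) (LDiv s t)"
    if "a \<in> carrier S" for a
    unfolding eq using LDiv that by simp
  ultimately show ?case by (intro conjI ballI)
qed (simp add: v)

end

theorem theorem3p7:
  fixes S :: "('a, 'c) qstruct_scheme" and T :: "('b, 'd) qstruct_scheme"
    and p q :: qterm
  assumes "quandle S" and "medial_quandle T"
  shows "satisfies_identity T p q \<longleftrightarrow> satisfies_identity (Hom_quandle S T) p q"
proof
  note eval = qeval_Hom_quandle[OF assms]
  assume T: "satisfies_identity T p q"
  show "satisfies_identity (Hom_quandle S T) p q"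
    unfolding satisfies_identity_def carrier_Hom_quandle
  proof (intro allI impI)
    fix v :: "nat \<Rightarrow> 'a \<Rightarrow> 'b" assume v: "\<forall>i. v i \<in> quandle_hom S T"
    show "qeval (Hom_quandle S T) v p = qeval (Hom_quandle S T) v q"
    proof (rule quandle_hom_eqI[of _ S T])
      fix a assume a: "a \<in> carrier S"
      \<comment> \<open>Freezing the point \<open>a\<close> turns \<open>v\<close> into a valuation
        in \<open>T\<close>, to which the identity of \<open>T\<close> applies.\<close>
      have "v i a \<in> carrier T" for i
        using v a by (simp add: quandle_hom_closed[of _ S])
      then have "qeval T (\<lambda>i. v i a) p = qeval T (\<lambda>i. v i a) q"
        by (rule T[unfolded satisfies_identity_def, rule_format])
      then show "qeval (Hom_quandle S T) v p a = qeval (Hom_quandle S T) v q a"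
        using eval[of v p] eval[of v q] v a by simp
    qed (use eval[of v p] eval[of v q] v in simp_all)
  qed
next
  assume H: "satisfies_identity (Hom_quandle S T) p q"
  \<comment> \<open>A point of \<open>S\<close> is needed to read off the value of a constant
    map.\<close>
  obtain a where a: "a \<in> carrier S"
    using quandle.nonempty[OF assms(1)] by blast
  show "satisfies_identity T p q"
    unfolding satisfies_identity_def
  proof (intro allI impI)
    fix v :: "nat \<Rightarrow> 'b" assume v: "\<forall>i. v i \<in> carrier T"
    define c where "c i = (\<lambda>a\<in>carrier S. v i)" for i
    have c: "c i \<in> quandle_hom S T" for i
      using v const_in_quandle_hom[OF assms(1) medial_quandle.axioms(1)[OF assms(2)]]
      by (simp add: c_def)
    \<comment> \<open>At \<open>a\<close> the valuation by constant maps becomes \<open>v\<close>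
      itself, so evaluating there recovers the value of the term in \<open>T\<close>.\<close>
    have "qeval (Hom_quandle S T) c t a = qeval T v t" for t
      using qeval_Hom_quandle[OF assms, of c t] c a by (simp add: c_def)
    moreover have "qeval (Hom_quandle S T) c p = qeval (Hom_quandle S T) c q"
      using H c by (simp add: satisfies_identity_def)
    ultimately show "qeval T v p = qeval T v q" by metis
  qed
qed

end
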